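(* The normal remoteness $R^+$ of paths satisfies: 1. $R^+(P_1)=R^+(P_2)=R^+(P_3)=1$; 2. $R^+(P_4)=R^+(P_5)=2$; 3. $R^+(P_6)=R^+(P_7)=R^+(P_8)=3$; 4. $R^+(P_9)=R^+(P_{10})=4$; 5. $R^+(P_n)=3$ for every $n\ge 11$.
   Context: For $n\ge 0$, $P_n$ denotes the path on $n$ vertices ($P_0$ is the empty graph). A Node-Kayles move on a path $P_k$ with $k\ge 1$ chooses a vertex and deletes it together with its neighbours. The possible results are: $P_0$ if $k\in\{1,2\}$; $P_0$ or $P_1$ if $k=3$; and, for $k\ge 4$, $P_{k-2}$, $P_{k-3}$, or two paths $P_i,P_j$ with $j\ge i\ge1$, $i+j=k-3$. In the conjunctive compound game, a position $G$ is a finite multiset of paths (components). A move replaces every component simultaneously by the result of a Node-Kayles move on it; a component that splits into two paths yields two components. The set $O(G)$ of options of $G$ consists of all positions obtainable by one such move. In particular $O(G)=\emptyset$ as soon as some component is $P_0$. The normal remoteness $R^+$ is defined recursively as follows: - $R^+(G)=0$ if $O(G)=\emptyset$; - $R^+(G)=1+\min\{R^+(G'):G'\in O(G),\ R^+(G')\text{ even}\}$ if some option has even remoteness; - $R^+(G)=1+\max\{R^+(G'):G'\in O(G)\}$ otherwise, in which case all these values are odd. $R^+(P_n)$ denotes the remoteness of the position consisting of the single component $P_n$. *)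

theory Defs
  imports Main "HOL-Library.Multiset"
begin

text \<open>
  The path \<open>P\<^sub>k\<close> is represented by its number of vertices \<open>k\<close>, a position by the multiset of
  its components.  Deleting the vertex \<open>v\<close> of the path \<open>1, \<dots>, k\<close> together with its neighbours leaves
  the vertices \<open>1, \<dots>, v - 2\<close> and \<open>v + 2, \<dots>, k\<close>; truncated subtraction counts both parts correctly
  at the ends of the path.  Empty parts are discarded, except that a path which is deleted
  completely leaves a component \<open>P\<^sub>0\<close>.
\<close>

definition delete_nbhd :: "nat \<Rightarrow> nat \<Rightarrow> nat multiset" where
  "delete_nbhd k v =
    (let parts = filter_mset (\<lambda>m. m \<noteq> 0) {#v - 2, k - v - 1#}
     in if parts = {#} then {#0#} else parts)"

definition path_moves :: "nat \<Rightarrow> nat multiset set" where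
  "path_moves k = delete_nbhd k ` {1..k}"

lemma path_moves_0: "path_moves 0 = {}"
  by (simp add: path_moves_def)

lemma path_moves_1: "path_moves 1 = {{#0#}}"
  by (simp add: path_moves_def delete_nbhd_def)

lemma path_moves_2: "path_moves 2 = {{#0#}}"
proof -
  have "{1..2::nat} = {1, 2}" by auto
  then show ?thesis by (simp add: path_moves_def delete_nbhd_def)
qed

lemma path_moves_3: "path_moves 3 = {{#0#}, {#1#}}"
proof -
  have "{1..3::nat} = {1, 2, 3}" by auto
  then show ?thesis by (auto simp: path_moves_def delete_nbhd_def)
qed

lemma path_moves_ge_4:
  assumes "k \<ge> 4"
  shows "path_moves k =
    {{#k - 2#}, {#k - 3#}} \<union> {{#i, j#} | i j. 1 \<le> i \<and> i \<le> j \<and> i + j = k - 3}" (is "_ = ?R")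
proof (intro equalityI subsetI)
  fix M assume "M \<in> path_moves k"
  then obtain v where v: "1 \<le> v" "v \<le> k" "M = delete_nbhd k v"
    by (auto simp: path_moves_def)
  consider "v = 1" | "v = 2" | "v = k - 1" | "v = k" | "3 \<le> v" "v \<le> k - 2"
    using v by linarith
  then show "M \<in> ?R"
  proof cases
    case 5
    have M: "M = {#v - 2, k - v - 1#}" "M = {#k - v - 1, v - 2#}"
      using v 5 assms by (auto simp: delete_nbhd_def add_mset_commute)
    show ?thesis
    proof (cases "v - 2 \<le> k - v - 1")
      case True
      moreover have "1 \<le> v - 2" "v - 2 + (k - v - 1) = k - 3" using 5 assms by auto
      ultimately show ?thesis using M(1) by blast
    next
      case False
      moreover have "1 \<le> k - v - 1" "k - v - 1 + (v - 2) = k - 3" using 5 assms by auto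
      ultimately show ?thesis using M(2) nat_le_linear by blast
    qed
  qed (use v assms in \<open>auto simp: delete_nbhd_def numeral_eq_Suc\<close>)
next
  fix M assume "M \<in> ?R"
  then consider "M = {#k - 2#}" | "M = {#k - 3#}"
    | i j where "M = {#i, j#}" "1 \<le> i" "i \<le> j" "i + j = k - 3"
    by auto
  then have "\<exists>v\<in>{1..k}. M = delete_nbhd k v"
  proof cases
    case 1
    then show ?thesis using assms by (intro bexI[of _ 1]) (auto simp: delete_nbhd_def)
  next
    case 2
    then show ?thesis using assms
      by (intro bexI[of _ 2]) (auto simp: delete_nbhd_def numeral_eq_Suc)
  next
    case 3
    then have "k - (i + 2) - 1 = j" by auto
    with 3 assms show ?thesis by (intro bexI[of _ "i + 2"]) (auto simp: delete_nbhd_def)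
  qed
  then show "M \<in> path_moves k" by (auto simp: path_moves_def)
qed

text \<open>
  The multiset \<open>H\<close> below collects, for every component of \<open>G\<close>, the outcome of the move made in it.
  The position without any component is not reachable from any other position; it has no move.
\<close>

definition options :: "nat multiset \<Rightarrow> nat multiset set" where
  "options G = {\<Sum>\<^sub># H | H. G \<noteq> {#} \<and> rel_mset (\<lambda>k M. M \<in> path_moves k) G H}"

lemma options_P0: "0 \<in># G \<Longrightarrow> options G = {}"
proof -
  assume G: "0 \<in># G"
  have False if "rel_mset (\<lambda>k M. M \<in> path_moves k) G H" for H
  proof -
    from G obtain G' where "G = add_mset 0 G'" by (meson mset_add)
    with that show False by (metis empty_iff msed_rel_invL path_moves_0)
  qed
  then show ?thesis by (auto simp: options_def)
qed

lemma path_moves_less: "M \<in> path_moves k \<Longrightarrow> sum_mset M < k"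
  by (auto simp: path_moves_def delete_nbhd_def Let_def)

lemma options_less:
  assumes "G' \<in> options G"
  shows "sum_mset G' < sum_mset G"
proof -
  have *: "sum_mset (\<Sum>\<^sub># H) + size G \<le> sum_mset G"
    if "rel_mset (\<lambda>k M. M \<in> path_moves k) G H" for G H
    using that
  proof (induction G arbitrary: H)
    case (add k G)
    then obtain M H' where "H = add_mset M H'" "M \<in> path_moves k"
      "rel_mset (\<lambda>k M. M \<in> path_moves k) G H'"
      by (metis msed_rel_invL)
    with add.IH[of H'] path_moves_less[of M k] show ?case by auto
  qed simp
  obtain H where "G' = \<Sum>\<^sub># H" "G \<noteq> {#}" "rel_mset (\<lambda>k M. M \<in> path_moves k) G H"
    using assms by (auto simp: options_def)
  moreover have "size G > 0" using \<open>G \<noteq> {#}\<close> by (simp add: nonempty_has_size)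
  ultimately show ?thesis using *[of G H] by simp
qed

lemma options_finite: "finite (options G)"
proof -
  have "finite {H. rel_mset (\<lambda>k M. M \<in> path_moves k) G H}" for G
  proof (induction G)
    case (add k G)
    have "{H. rel_mset (\<lambda>k M. M \<in> path_moves k) (add_mset k G) H}
        \<subseteq> (\<lambda>(M, H). add_mset M H) `
            (path_moves k \<times> {H. rel_mset (\<lambda>k M. M \<in> path_moves k) G H})"
      by (fastforce dest: msed_rel_invL)
    moreover have "finite (path_moves k)" by (simp add: path_moves_def)
    ultimately show ?case using add by (auto intro: finite_subset)
  qed simp
  then have "finite (sum_mset ` {H. rel_mset (\<lambda>k M. M \<in> path_moves k) G H})" by blast
  then show ?thesis by (rule rev_finite_subset) (auto simp: options_def)
qed

function normal_remoteness :: "nat multiset \<Rightarrow> nat" where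
  "normal_remoteness G =
    (if options G = {} then 0
     else if \<exists>G'\<in>options G. even (normal_remoteness G')
       then 1 + Min {r \<in> normal_remoteness ` options G. even r}
     else 1 + Max (normal_remoteness ` options G))"
  by pat_completeness auto
termination
  by (relation "measure sum_mset") (auto intro: options_less)

declare normal_remoteness.simps [simp del]

end

theory Submission
  imports Defs
begin

text \<open>
  A position with a component \<open>P\<^sub>0\<close> has remoteness 0, and one whose smallest component is \<open>P\<^sub>1\<close>,
  \<open>P\<^sub>2\<close> or \<open>P\<^sub>3\<close> can be moved there, so it has remoteness 1.  If all components have at least 4
  vertices and one of them is \<open>P\<^sub>4\<close> or \<open>P\<^sub>5\<close>, then every option is of the previous kind, because
  \<open>P\<^sub>4\<close> and \<open>P\<^sub>5\<close> always leave a component with at most 3 vertices and nothing vanishes; the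
  remoteness is 2.  From \<open>P\<^sub>6\<close>, \<open>P\<^sub>7\<close>, \<open>P\<^sub>8\<close> one can move to \<open>P\<^sub>4\<close> or \<open>P\<^sub>5\<close>, and from \<open>P\<^sub>n\<close> with
  \<open>n \<ge> 11\<close> to the pair \<open>P\<^sub>4\<close>, \<open>P\<^bsub>n - 7\<^esub>\<close>, whence remoteness 3.  Only \<open>P\<^sub>9\<close> and \<open>P\<^sub>1\<^sub>0\<close> admit neither:
  their options all have remoteness 1 or 3.
\<close>

lemma options_singleton: "options {#k#} = path_moves k"
proof (intro equalityI subsetI)
  fix G assume "G \<in> options {#k#}"
  then obtain H where H: "G = \<Sum>\<^sub># H" "rel_mset (\<lambda>k M. M \<in> path_moves k) {#k#} H"
    by (auto simp: options_def)
  from msed_rel_invL[OF H(2)] H(1) show "G \<in> path_moves k" by auto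
next
  fix M assume "M \<in> path_moves k"
  then have "rel_mset (\<lambda>k M. M \<in> path_moves k) {#k#} {#M#}"
    by (intro rel_mset_Plus rel_mset_Zero)
  then show "M \<in> options {#k#}"
    unfolding options_def by (intro CollectI exI[of _ "{#M#}"]) auto
qed

lemma ex_option_containing_move:
  assumes "0 \<notin># G" "k \<in># G" "M \<in> path_moves k"
  shows "\<exists>G'\<in>options G. M \<subseteq># G'"
proof -
  obtain G0 where G: "G = add_mset k G0" using assms(2) by (meson mset_add)
  \<comment> \<open>Every component must move; deleting vertex 1 is legal in each nonempty path, so
    it serves as the default move outside \<open>k\<close>.\<close>
  have "rel_mset (\<lambda>k M. M \<in> path_moves k) G0 (image_mset (\<lambda>k. delete_nbhd k 1) G0)"
    if "0 \<notin># G0" for G0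
    using that by (induction G0) (auto intro!: rel_mset_Zero rel_mset_Plus simp: path_moves_def)
  then have "rel_mset (\<lambda>k M. M \<in> path_moves k) G
      (add_mset M (image_mset (\<lambda>k. delete_nbhd k 1) G0))"
    using assms G by (auto intro: rel_mset_Plus)
  then have "M + (\<Sum>k\<in>#G0. delete_nbhd k 1) \<in> options G"
    unfolding options_def using G by force
  then show ?thesis by (rule bexI[rotated]) simp
qed

lemma options_nonempty:
  assumes "0 \<notin># G" "G \<noteq> {#}"
  shows "options G \<noteq> {}"
proof -
  obtain k where "k \<in># G" using assms(2) by blast
  moreover from this have "delete_nbhd k 1 \<in> path_moves k"
    using assms(1) by (cases k) (auto simp: path_moves_def)
  ultimately show ?thesis using ex_option_containing_move assms(1) by blast
qed

lemma option_contains_move: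
  assumes "G' \<in> options G" "k \<in># G"
  shows "\<exists>M\<in>path_moves k. M \<subseteq># G'"
proof -
  obtain G0 where "G = add_mset k G0" using assms(2) by (meson mset_add)
  then show ?thesis
    using assms(1) by (auto simp: options_def dest!: msed_rel_invL intro!: bexI[rotated])
qed

text \<open>Tracing a component of an option back to its origin serves to rule out \<open>0\<close>
  in options of positions whose paths are all long.\<close>

lemma member_option_from_move:
  assumes "G' \<in> options G" "x \<in># G'"
  shows "\<exists>k\<in>#G. \<exists>M\<in>path_moves k. x \<in># M"
proof -
  have "\<exists>k\<in>#G. \<exists>M\<in>path_moves k. x \<in># M"
    if "rel_mset (\<lambda>k M. M \<in> path_moves k) G H" "x \<in># \<Sum>\<^sub># H" for H
    using that
  proof (induction G arbitrary: H)
    case (add k G)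
    then show ?case by (fastforce dest: msed_rel_invL)
  qed simp
  then show ?thesis using assms by (auto simp: options_def)
qed

lemma move_ne_empty: "M \<in> path_moves k \<Longrightarrow> M \<noteq> {#}"
  by (auto simp: path_moves_def delete_nbhd_def Let_def)

lemma zero_notin_move: "4 \<le> k \<Longrightarrow> M \<in> path_moves k \<Longrightarrow> 0 \<notin># M"
  by (auto simp: path_moves_ge_4)

lemma normal_remoteness_eq_0_iff: "normal_remoteness G = 0 \<longleftrightarrow> options G = {}"
  by (subst normal_remoteness.simps) simp

lemma normal_remoteness_P0: "0 \<in># G \<Longrightarrow> normal_remoteness G = 0"
  by (simp add: normal_remoteness_eq_0_iff options_P0)

lemma normal_remoteness_min_even:
  assumes "G' \<in> options G" "even (normal_remoteness G')"
    and "\<And>G''. G'' \<in> options G \<Longrightarrow> even (normal_remoteness G'')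
      \<Longrightarrow> normal_remoteness G' \<le> normal_remoteness G''"
  shows "normal_remoteness G = 1 + normal_remoteness G'"
proof -
  have "Min {r \<in> normal_remoteness ` options G. even r} = normal_remoteness G'"
    using assms by (intro Min_eqI) (auto simp: options_finite)
  then show ?thesis using assms(1,2) by (subst normal_remoteness.simps) auto
qed

lemma normal_remoteness_all_odd:
  assumes "\<And>G''. G'' \<in> options G \<Longrightarrow> odd (normal_remoteness G'')"
    and "G' \<in> options G"
    and "\<And>G''. G'' \<in> options G \<Longrightarrow> normal_remoteness G'' \<le> normal_remoteness G'"
  shows "normal_remoteness G = 1 + normal_remoteness G'"
proof -
  have "Max (normal_remoteness ` options G) = normal_remoteness G'"
    using assms by (intro Max_eqI) (auto simp: options_finite)
  then show ?thesis using assms(1,2) by (subst normal_remoteness.simps) auto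
qed

text \<open>Some vertex of the short path dominates it, so this path can vanish; the resulting
  remoteness 0 is the least even value.\<close>

lemma normal_remoteness_eq_1:
  assumes "0 \<notin># G" "k \<in># G" "k \<le> 3"
  shows "normal_remoteness G = 1"
proof -
  have "k \<noteq> 0" using assms(1,2) by metis
  then have "k = 1 \<or> k = 2 \<or> k = 3" using assms(3) by linarith
  then have "{#0#} \<in> path_moves k" using path_moves_1 path_moves_2 path_moves_3 by auto
  then obtain G' where G': "G' \<in> options G" "{#0#} \<subseteq># G'"
    using ex_option_containing_move assms(1,2) by blast
  then have "normal_remoteness G' = 0" by (simp add: normal_remoteness_P0)
  then show ?thesis using normal_remoteness_min_even[OF G'(1)] by simp
qed

lemma normal_remoteness_eq_2:
  assumes ge: "\<forall>m\<in>#G. 4 \<le> m" and k: "k \<in># G" "k \<le> 5"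
  shows "normal_remoteness G = 2"
proof -
  have one: "normal_remoteness G' = 1" if G': "G' \<in> options G" for G'
  proof -
    obtain M where M: "M \<in> path_moves k" "M \<subseteq># G'"
      using option_contains_move[OF G' k(1)] by blast
    obtain x where x: "x \<in># M" using move_ne_empty[OF M(1)] by blast
    have "4 \<le> k" using ge k(1) by blast
    \<comment> \<open>Parts have at most \<open>k - 2\<close> vertices, and
      \<open>k - 2 \<le> 3\<close>.\<close>
    then have "x \<le> 3" using M(1) x k(2) by (auto simp: path_moves_ge_4)
    moreover have "0 \<notin># G'"
      using member_option_from_move[OF G'] ge zero_notin_move by blast
    ultimately show ?thesis
      using normal_remoteness_eq_1 x M(2) by (meson mset_subset_eqD)
  qed
  have "options G \<noteq> {}" using ge k(1) by (intro options_nonempty) fastforce+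
  then obtain G' where "G' \<in> options G" by blast
  then show ?thesis using normal_remoteness_all_odd[of G G'] one by simp
qed

text \<open>No option of a path with at least 4 vertices contains \<open>0\<close>, so every option
  has positive remoteness and 2 is the least even value possible.\<close>

lemma normal_remoteness_path_eq_3:
  assumes "4 \<le> n" "G' \<in> path_moves n" "normal_remoteness G' = 2"
  shows "normal_remoteness {#n#} = 3"
proof -
  have "2 \<le> normal_remoteness G''" if "G'' \<in> path_moves n" "even (normal_remoteness G'')" for G''
  proof -
    have "normal_remoteness G'' \<noteq> 0"
      using options_nonempty zero_notin_move[OF assms(1) that(1)] move_ne_empty[OF that(1)]
      by (simp add: normal_remoteness_eq_0_iff)
    then show ?thesis using that(2) by presburger
  qed
  then show ?thesis
    using normal_remoteness_min_even[of G' "{#n#}"] assms by (simp add: options_singleton)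
qed

lemma normal_remoteness_P6_P7_P8:
  assumes "n \<in> {6, 7, 8}"
  shows "normal_remoteness {#n#} = 3"
proof -
  \<comment> \<open>The targets for 6, 7, 8 are 4, 4, 5; for 6 the end vertex is chosen, since
    \<open>n - 3\<close> would be only 3.\<close>
  have "{#if n = 6 then 4 else n - 3#} \<in> path_moves n"
    using assms by (auto simp: path_moves_ge_4)
  moreover have "normal_remoteness {#if n = 6 then 4 else n - 3#} = 2"
    using assms by (intro normal_remoteness_eq_2) auto
  ultimately show ?thesis using assms by (intro normal_remoteness_path_eq_3) auto
qed

lemma normal_remoteness_path_ge_11:
  assumes "11 \<le> n"
  shows "normal_remoteness {#n#} = 3"
proof -
  \<comment> \<open>The bound 11 is exactly what lets both parts have at least 4 vertices.\<close>
  have "4 + (n - 7) = n - 3" "4 \<le> n - 7" using assms by auto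
  then have "{#4, n - 7#} \<in> path_moves n"
    using assms by (subst path_moves_ge_4) force+
  moreover have "normal_remoteness {#4, n - 7#} = 2"
    using assms by (intro normal_remoteness_eq_2[of _ 4]) auto
  ultimately show ?thesis using assms by (intro normal_remoteness_path_eq_3) auto
qed

lemma normal_remoteness_P9_P10:
  assumes "n \<in> {9, 10}"
  shows "normal_remoteness {#n#} = 4"
proof -
  have n: "4 \<le> n" using assms by auto
  have opts: "normal_remoteness M = 1 \<or> normal_remoteness M = 3" if M: "M \<in> path_moves n" for M
  proof -
    consider "M = {#n - 2#}" | "M = {#n - 3#}"
      | i j where "M = {#i, j#}" "1 \<le> i" "i \<le> j" "i + j = n - 3"
      using M path_moves_ge_4[OF n] by auto
    then show ?thesis
    proof cases
      case 3
      \<comment> \<open>The smaller part is at most half of \<open>n - 3 \<le> 7\<close>.\<close>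
      then have "i \<le> 3" using assms by auto
      then show ?thesis using 3 by (intro disjI1 normal_remoteness_eq_1[of _ i]) auto
    \<comment> \<open>Here \<open>n - 2\<close> and \<open>n - 3\<close> lie in {6, 7, 8}.\<close>
    qed (use assms in \<open>auto simp: normal_remoteness_P6_P7_P8\<close>)
  qed
  \<comment> \<open>This option attains the maximum 3 of the odd values 1 and 3.\<close>
  have "{#n - 2#} \<in> path_moves n" using path_moves_ge_4[OF n] by auto
  moreover have "normal_remoteness {#n - 2#} = 3"
    using assms by (intro normal_remoteness_P6_P7_P8) auto
  ultimately show ?thesis
    using normal_remoteness_all_odd[of "{#n#}" "{#n - 2#}"] opts
    by (fastforce simp: options_singleton)
qed

theorem theorem2:
  shows "(\<forall>n\<in>{1, 2, 3}. normal_remoteness {#n#} = 1) \<and>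
    (\<forall>n\<in>{4, 5}. normal_remoteness {#n#} = 2) \<and>
    (\<forall>n\<in>{6, 7, 8}. normal_remoteness {#n#} = 3) \<and>
    (\<forall>n\<in>{9, 10}. normal_remoteness {#n#} = 4) \<and>
    (\<forall>n\<ge>11. normal_remoteness {#n#} = 3)"
proof (intro conjI ballI allI impI)
  fix n :: nat assume "n \<in> {1, 2, 3}"
  then show "normal_remoteness {#n#} = 1" by (intro normal_remoteness_eq_1) auto
next
  fix n :: nat assume "n \<in> {4, 5}"
  then show "normal_remoteness {#n#} = 2" by (intro normal_remoteness_eq_2) auto
qed (fact normal_remoteness_P6_P7_P8 normal_remoteness_P9_P10 normal_remoteness_path_ge_11)+

end
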